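(* Let $T(\lambda)$ be a solution of the reflection equation $$R_{12}(\lambda_1-\lambda_2)\,T_1(\lambda_1)\,R_{21}(\lambda_1+\lambda_2)\,T_2(\lambda_2)=T_2(\lambda_2)\,R_{12}(\lambda_1+\lambda_2)\,T_1(\lambda_1)\,R_{21}(\lambda_1-\lambda_2),$$ where $T(\lambda)\in \mathrm{End}(V)$ has operator entries acting on a quantum space. For every ordered set $\mathcal N=\langle 1,2,\dots,n\rangle$ of labels put $$\mathcal T^0_{\mathcal N}(\lambda_{\mathcal N})=T_1\,R_{21}(\lambda_1+\lambda_2)R_{31}(\lambda_1+\lambda_3)\cdots R_{n1}(\lambda_1+\lambda_n)\;T_2\,R_{32}(\lambda_2+\lambda_3)\cdots R_{n2}(\lambda_2+\lambda_n)\;T_3\cdots T_k\,R_{k+1,k}(\lambda_k+\lambda_{k+1})\cdots R_{nk}(\lambda_k+\lambda_n)\;T_{k+1}\cdots T_{n-1}\,R_{n,n-1}(\lambda_n+\lambda_{n-1})\;T_n ,$$ with $T_i=T_i(\lambda_i)$. Then the objects $\mathcal T^0_{\mathcal N}$ are solutions of the set of generalized reflection equations: for all disjoint ordered sets of labels $\mathcal N=\langle 1,\dots,n\rangle$ and $\mathcal M'=\langle 1',\dots,m'\rangle$, $$\mathcal T^0_{\mathcal N}(\lambda_{\mathcal N})\,R_{\mathcal M'\mathcal N}(\lambda_{\mathcal N}+\lambda_{\mathcal M'})\,\mathcal T^0_{\mathcal M'}(\lambda_{\mathcal M'})\,R_{\bar{\mathcal N}\mathcal M'}(-\lambda_{\bar{\mathcal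 N}}+\lambda_{\mathcal M'})=R_{\mathcal M'\bar{\mathcal N}}(-\lambda_{\bar{\mathcal N}}+\lambda_{\mathcal M'})\,\mathcal T^0_{\mathcal M'}(\lambda_{\mathcal M'})\,R_{\mathcal N\mathcal M'}(\lambda_{\mathcal N}+\lambda_{\mathcal M'})\,\mathcal T^0_{\mathcal N}(\lambda_{\mathcal N}).$$
   Context: $V$ is a finite-dimensional complex vector space (auxiliary space); $V_i$ denotes a copy of $V$ labelled by $i$, and subscripts indicate the copies on which an operator acts. To each label $i$ is attached a spectral parameter $\lambda_i\in\mathbb C$. All identities hold for generic values of the parameters (as identities of matrix-valued functions). $R(\lambda)\in\mathrm{End}(V\otimes V)$ is a c-number matrix, $R_{21}=P_{12}R_{12}P_{12}$ with $P_{12}$ the permutation of the two factors, and $t_i$ denotes transposition in the space $V_i$. Standing assumptions on $R$: (I) Yang--Baxter equation: $R_{12}(\lambda_1-\lambda_2)R_{13}(\lambda_1)R_{23}(\lambda_2)=R_{23}(\lambda_2)R_{13}(\lambda_1)R_{12}(\lambda_1-\lambda_2)$. (II) $R_{12}(\lambda)=R_{21}(\lambda)^{t_1t_2}$. (III) Unitarity $R_{12}(\lambda)R_{21}(-\lambda)\propto 1$; crossing $R_{12}(\lambda)=V_1R_{12}^{t_2}(-\lambda-\rho)V_1=V_2^{t_2}R_{12}^{t_1}(-\lambda-\rho)V_2^{t_2}$; crossing-unitarity $R_{21}(\lambda)^{t_1}M_1^{-1}R_{12}(-\lambda-2\rho)^{t_1}M_1\propto 1$; and $[R_{12}(\lambda),M_1M_2]=0$.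 Here (in these crossing formulas only) $V_i$ denotes a c-number matrix $V$ with $V^2=1$ acting on the $i$-th space, $M=V^tV$, and $\rho$ is a fixed constant. The sign $\propto$ means equality up to a nonzero scalar function. Fused $R$-matrices: for disjoint ordered sets of labels $\mathcal X=\langle x_1,\dots,x_a\rangle$ and $\mathcal Y=\langle y_1,\dots,y_b\rangle$, $$R_{\mathcal X\mathcal Y}=\big(R_{x_1y_1}R_{x_2y_1}\cdots R_{x_ay_1}\big)\big(R_{x_1y_2}\cdots R_{x_ay_2}\big)\cdots\big(R_{x_1y_b}\cdots R_{x_ay_b}\big).$$ An argument such as $\epsilon\lambda_{\mathcal X}+\epsilon'\lambda_{\mathcal Y}+c$ means that each factor $R_{xy}$ is evaluated at $\epsilon\lambda_x+\epsilon'\lambda_y+c$. For an ordered set $\mathcal N=\langle 1,\dots,n\rangle$, $\bar{\mathcal N}=\langle n,n-1,\dots,1\rangle$ is the set in reversed order. $T_i(\lambda_i)$ is the matrix $T(\lambda_i)$ acting on the auxiliary space $V_i$, whose entries are (in general noncommuting) operators on one and the same quantum space, possibly including an additional boundary quantum space. The quantum labels are omitted. $\mathcal T^0_{\mathcal M'}$ is given by the same formula as $\mathcal T^0_{\mathcal N}$ with labels $1',\dots,m'$; for $n=1$, $\mathcal T^0_{\langle1\rangle}=T_1(\lambda_1)$. *)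

theory Defs
  imports "HOL-Analysis.Analysis" "HOL-Library.Numeral_Type"
begin

text \<open>
  An identity between matrix-valued functions of spectral parameters is required only for generic values
  of the parameters, i.e. away from a closed nowhere dense set (which absorbs, for instance, the
  poles of the functions involved).
\<close>

definition generic :: "('a::topological_space \<Rightarrow> bool) \<Rightarrow> bool" where
  "generic P \<longleftrightarrow> (\<exists>U. open U \<and> closure U = UNIV \<and> (\<forall>x\<in>U. P x))"

text \<open>
  The auxiliary space is \<open>V = \<complex>\<^sup>v\<close>, where the basis is indexed by the finite type \<open>'v\<close>. Elements of
  \<open>End V\<close> and \<open>End (V \<otimes> V)\<close> are complex matrices, the basis of \<open>V \<otimes> V\<close> being indexed by pairs.
  The following operations live on \<open>V\<^sub>1 \<otimes> V\<^sub>2\<close>.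
\<close>

type_synonym 'v mat1 = "complex ^ 'v ^ 'v"
type_synonym 'v mat2 = "complex ^ ('v \<times> 'v) ^ ('v \<times> 'v)"

definition perm12 :: "'v::finite mat2" where
  "perm12 = (\<chi> p q. if fst p = snd q \<and> snd p = fst q then 1 else 0)"

definition flip :: "'v::finite mat2 \<Rightarrow> 'v mat2" where
  "flip X = perm12 ** X ** perm12"

definition transp1 :: "'v::finite mat2 \<Rightarrow> 'v mat2" where
  "transp1 X = (\<chi> p q. X $ (fst q, snd p) $ (fst p, snd q))"

definition transp2 :: "'v::finite mat2 \<Rightarrow> 'v mat2" where
  "transp2 X = (\<chi> p q. X $ (fst p, snd q) $ (fst q, snd p))"

definition on1 :: "'v::finite mat1 \<Rightarrow> 'v mat2" where
  "on1 A = (\<chi> p q. A $ fst p $ fst q * (if snd p = snd q then 1 else 0))"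

definition on2 :: "'v::finite mat1 \<Rightarrow> 'v mat2" where
  "on2 A = (\<chi> p q. (if fst p = fst q then 1 else 0) * A $ snd p $ snd q)"

text \<open>Equality to the identity up to a scalar function that is nonzero at generic points.\<close>

definition prop_to_one :: "(complex \<Rightarrow> 'v::finite mat2) \<Rightarrow> bool" where
  "prop_to_one F \<longleftrightarrow> (\<exists>c :: complex \<Rightarrow> complex. generic (\<lambda>u. c u \<noteq> 0 \<and> F u = mat (c u)))"

text \<open>
  Let \<open>'l\<close> be a finite type of labels and \<open>'w\<close> a complex vector space (the quantum space) with scalar
  multiplication \<open>s\<close>. A vector of the tensor product of \<open>'w\<close> with one copy of \<open>V\<close> for each label is
  given by its components: for every \<open>f :: 'l \<Rightarrow> 'v\<close>, the coefficient in \<open>'w\<close> of the basis vector that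
  carries \<open>f x\<close> in the copy labelled \<open>x\<close>. Operators on this space are multiplied by \<open>(\<circ>)\<close>.

  \<open>Rop s X x y\<close> is the matrix \<open>X\<close> with its first factor acting in the copy \<open>x\<close> and its second factor
  in the copy \<open>y\<close> (meaningful for \<open>x \<noteq> y\<close>); \<open>Top A x\<close> is the matrix \<open>A\<close>, whose entries are operators
  on the quantum space, acting in the copy \<open>x\<close>.
\<close>

type_synonym ('l, 'v, 'w) tens = "('l \<Rightarrow> 'v) \<Rightarrow> 'w"

definition Rop :: "(complex \<Rightarrow> 'w \<Rightarrow> 'w) \<Rightarrow> 'v::finite mat2 \<Rightarrow> 'l \<Rightarrow> 'l \<Rightarrow>
    ('l, 'v, 'w::ab_group_add) tens \<Rightarrow> ('l, 'v, 'w) tens" where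
  "Rop s X x y \<psi> = (\<lambda>f. \<Sum>a\<in>UNIV. \<Sum>b\<in>UNIV. s (X $ (f x, f y) $ (a, b)) (\<psi> (f(x := a, y := b))))"

definition Top :: "('v::finite \<Rightarrow> 'v \<Rightarrow> 'w \<Rightarrow> 'w) \<Rightarrow> 'l \<Rightarrow>
    ('l, 'v, 'w::ab_group_add) tens \<Rightarrow> ('l, 'v, 'w) tens" where
  "Top A x \<psi> = (\<lambda>f. \<Sum>a\<in>UNIV. A (f x) a (\<psi> (f(x := a))))"

text \<open>The label type \<open>3\<close> (and \<open>2\<close> below) consists of residues, so \<open>3 = 0\<close> there; \<open>1, 2, 3\<close> are distinct.\<close>

definition yang_baxter :: "(complex \<Rightarrow> 'v::finite mat2) \<Rightarrow> bool" where
  "yang_baxter R \<longleftrightarrow> generic (\<lambda>(l1, l2).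
      (Rop (*) (R (l1 - l2)) 1 2 \<circ> Rop (*) (R l1) 1 3 \<circ> Rop (*) (R l2) 2 3
        :: (3, 'v, complex) tens \<Rightarrow> _) =
      Rop (*) (R l2) 2 3 \<circ> Rop (*) (R l1) 1 3 \<circ> Rop (*) (R (l1 - l2)) 1 2)"

definition transp_symmetric :: "(complex \<Rightarrow> 'v::finite mat2) \<Rightarrow> bool" where
  "transp_symmetric R \<longleftrightarrow> generic (\<lambda>u. R u = transp1 (transp2 (flip (R u))))"

definition unitarity :: "(complex \<Rightarrow> 'v::finite mat2) \<Rightarrow> bool" where
  "unitarity R \<longleftrightarrow> prop_to_one (\<lambda>u. R u ** flip (R (- u)))"

definition crossing :: "(complex \<Rightarrow> 'v::finite mat2) \<Rightarrow> 'v mat1 \<Rightarrow> complex \<Rightarrow> bool" where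
  "crossing R V \<rho> \<longleftrightarrow> generic (\<lambda>u.
      R u = on1 V ** transp2 (R (- u - \<rho>)) ** on1 V \<and>
      R u = on2 (transpose V) ** transp1 (R (- u - \<rho>)) ** on2 (transpose V))"

definition crossing_unitarity :: "(complex \<Rightarrow> 'v::finite mat2) \<Rightarrow> 'v mat1 \<Rightarrow> complex \<Rightarrow> bool" where
  "crossing_unitarity R M \<rho> \<longleftrightarrow> prop_to_one (\<lambda>u.
      transp1 (flip (R u)) ** on1 (matrix_inv M) ** transp1 (R (- u - 2 * \<rho>)) ** on1 M)"

definition commutes_with :: "(complex \<Rightarrow> 'v::finite mat2) \<Rightarrow> 'v mat1 \<Rightarrow> bool" where
  "commutes_with R M \<longleftrightarrow> generic (\<lambda>u. R u ** (on1 M ** on2 M) = (on1 M ** on2 M) ** R u)"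

definition reflection_equation ::
    "(complex \<Rightarrow> 'w \<Rightarrow> 'w) \<Rightarrow> (complex \<Rightarrow> 'v::finite mat2) \<Rightarrow>
     (complex \<Rightarrow> 'v \<Rightarrow> 'v \<Rightarrow> 'w \<Rightarrow> 'w::ab_group_add) \<Rightarrow> bool" where
  "reflection_equation s R T \<longleftrightarrow> generic (\<lambda>(l1, l2).
      (Rop s (R (l1 - l2)) 1 2 \<circ> Top (T l1) 1 \<circ> Rop s (R (l1 + l2)) 2 1 \<circ> Top (T l2) 2
        :: (2, 'v, 'w) tens \<Rightarrow> _) =
      Top (T l2) 2 \<circ> Rop s (R (l1 + l2)) 1 2 \<circ> Top (T l1) 1 \<circ> Rop s (R (l1 - l2)) 2 1)"

definition op_prod :: "('a \<Rightarrow> 'a) list \<Rightarrow> 'a \<Rightarrow> 'a" where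
  "op_prod fs = foldr (\<circ>) fs id"

text \<open>
  Ordered sets of labels are lists without repetition. In \<open>fusedR s R \<alpha> X Y\<close> the factor acting in the
  copies \<open>x\<close>, \<open>y\<close> is evaluated at \<open>\<alpha> x y\<close>; the label from \<open>X\<close> runs fastest.
\<close>

definition fusedR :: "(complex \<Rightarrow> 'w \<Rightarrow> 'w) \<Rightarrow> (complex \<Rightarrow> 'v::finite mat2) \<Rightarrow> ('l \<Rightarrow> 'l \<Rightarrow> complex) \<Rightarrow>
    'l list \<Rightarrow> 'l list \<Rightarrow> ('l, 'v, 'w::ab_group_add) tens \<Rightarrow> ('l, 'v, 'w) tens" where
  "fusedR s R \<alpha> X Y = op_prod [Rop s (R (\<alpha> x y)) x y. y \<leftarrow> Y, x \<leftarrow> X]"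

fun fusedT :: "(complex \<Rightarrow> 'w \<Rightarrow> 'w) \<Rightarrow> (complex \<Rightarrow> 'v::finite mat2) \<Rightarrow>
    (complex \<Rightarrow> 'v \<Rightarrow> 'v \<Rightarrow> 'w \<Rightarrow> 'w) \<Rightarrow> complex ^ 'l \<Rightarrow>
    'l::finite list \<Rightarrow> ('l, 'v, 'w::ab_group_add) tens \<Rightarrow> ('l, 'v, 'w) tens" where
  "fusedT s R T lam [] = id"
| "fusedT s R T lam (x # xs) =
     Top (T (lam $ x)) x \<circ> op_prod [Rop s (R (lam $ x + lam $ y)) y x. y \<leftarrow> xs] \<circ> fusedT s R T lam xs"

end

theory Submission imports Defs begin

text \<open>
  The proof is the usual fusion argument: a product of local exchange relations is again an exchange
  relation, because factors acting in disjoint copies of the auxiliary space commute. Three facts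
  carry it, namely the Yang--Baxter equation, the reflection equation, and the linearity of the
  entries of \<open>T\<close>, which makes \<open>T\<^sub>x\<close> commute with the c-number matrices in other copies. Two matrices
  \<open>T\<^sub>x\<close> and \<open>T\<^sub>y\<close> do not commute, but are never exchanged except by the reflection equation.

  The whole computation takes place at one fixed value of the spectral parameters. Such a value
  is good (locale \<open>exchange_point\<close>) if the finitely many relations between two or three labels hold
  there. The arguments at which these relations are needed are pairs of independent linear forms in the
  parameters; a surjective linear map is open, so each relation holds on an open dense set, and so do
  all of them together (\<open>generic_exchange_point\<close>).

  At a good point, write \<open>R\<^sup>+\<close>, \<open>R\<^sup>-\<close> for factors with argument a sum or a difference of parameters. The
  Yang--Baxter equation in the two forms \<open>R\<^sup>-\<^sub>p\<^sub>q R\<^sup>+\<^sub>p\<^sub>r R\<^sup>+\<^sub>q\<^sub>r\<close> and \<open>R\<^sup>+\<^sub>p\<^sub>q R\<^sup>+\<^sub>p\<^sub>r R\<^sup>-\<^sub>q\<^sub>r\<close> is fused, one slot being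
  a list at a time. For \<open>N = \<langle>x\<rangle>\<close> the generalized reflection equation follows by induction on the
  other list: \<open>T\<^sub>x\<close> is carried past one \<open>T\<^sub>z\<close> by the reflection equation, the form with \<open>R\<^sup>-\<^sub>x\<^sub>z\<close> on the
  right brings the factors into position for this, and the other form restores the order afterwards
  (\<open>reflection_single\<close>). Induction on \<open>N\<close> repeats the same pattern one level up, with
  \<open>reflection_single\<close> in place of the reflection equation (\<open>reflection_fused\<close>).
\<close>

section \<open>Generic points\<close>

lemma dense_iff_meets_open:
  "closure U = UNIV \<longleftrightarrow> (\<forall>W. open W \<longrightarrow> W \<noteq> {} \<longrightarrow> U \<inter> W \<noteq> {})"
proof
  assume "closure U = UNIV"
  then show "\<forall>W. open W \<longrightarrow> W \<noteq> {} \<longrightarrow> U \<inter> W \<noteq> {}"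
    by (metis Int_UNIV_right inf_commute open_Int_closure_eq_empty)
next
  assume meets: "\<forall>W. open W \<longrightarrow> W \<noteq> {} \<longrightarrow> U \<inter> W \<noteq> {}"
  have "U \<inter> - closure U = {}"
    using closure_subset by blast
  then have "- closure U = {}"
    using meets open_Compl[OF closed_closure] by blast
  then show "closure U = UNIV" by blast
qed

lemma generic_mono:
  assumes "generic P" and "\<And>x. P x \<Longrightarrow> Q x"
  shows "generic Q"
  using assms unfolding generic_def by blast

lemma generic_True: "generic (\<lambda>x. True)"
  unfolding generic_def by (intro exI[of _ UNIV]) simp

lemma generic_conj:
  assumes "generic P" and "generic Q"
  shows "generic (\<lambda>x. P x \<and> Q x)"
proof -
  obtain U where U: "open U" "closure U = UNIV" "\<forall>x\<in>U. P x"
    using assms(1) unfolding generic_def by blast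
  obtain W where W: "open W" "closure W = UNIV" "\<forall>x\<in>W. Q x"
    using assms(2) unfolding generic_def by blast
  have "(U \<inter> W) \<inter> Z \<noteq> {}" if "open Z" "Z \<noteq> {}" for Z
  proof -
    have "W \<inter> Z \<noteq> {}" using W that by (simp add: dense_iff_meets_open)
    then have "U \<inter> (W \<inter> Z) \<noteq> {}"
      using U(2) open_Int[OF W(1) that(1)] by (simp add: dense_iff_meets_open)
    then show ?thesis by (simp add: Int_assoc)
  qed
  then have "closure (U \<inter> W) = UNIV"
    by (simp add: dense_iff_meets_open)
  then show ?thesis
    unfolding generic_def using U W by (intro exI[of _ "U \<inter> W"]) auto
qed

lemma generic_finite_all:
  fixes P :: "'i::finite \<Rightarrow> 'a::topological_space \<Rightarrow> bool"
  assumes "\<And>i. generic (P i)"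
  shows "generic (\<lambda>x. \<forall>i. P i x)"
proof -
  have "generic (\<lambda>x. \<forall>i\<in>I. P i x)" if "finite I" for I
    using that
  proof (induction I)
    case empty
    then show ?case by (simp add: generic_True)
  next
    case (insert i I)
    then show ?case using generic_conj[OF assms[of i] insert.IH] by simp
  qed
  from this[of UNIV] show ?thesis by simp
qed

lemma generic_imp:
  assumes "c \<Longrightarrow> generic P"
  shows "generic (\<lambda>x. c \<longrightarrow> P x)"
  using assms generic_True by (cases c) auto

text \<open>A surjective linear map is open, so that the preimage of a dense set is dense. This turns an
  identity in generic arguments into one in generic spectral parameters, as long as the arguments
  are independent linear combinations of the parameters.\<close>

lemma generic_linear_preimage:
  fixes f :: "'a::euclidean_space \<Rightarrow> 'b::euclidean_space"
  assumes P: "generic P" and lin: "linear f" and surj: "surj f"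
  shows "generic (\<lambda>x. P (f x))"
proof -
  obtain U where U: "open U" "closure U = UNIV" "\<forall>y\<in>U. P y"
    using P unfolding generic_def by blast
  have "f -` U \<inter> W \<noteq> {}" if "open W" "W \<noteq> {}" for W
  proof -
    have "open (f ` W)"
      using open_surjective_linear_image[OF that(1) lin surj] .
    then have "U \<inter> f ` W \<noteq> {}"
      using U(2) that(2) by (simp add: dense_iff_meets_open)
    then show ?thesis by blast
  qed
  moreover have "open (f -` U)"
    using U(1) linear_continuous_on[OF lin[unfolded linear_conv_bounded_linear], of UNIV]
    by (simp add: open_vimage)
  ultimately show ?thesis
    unfolding generic_def using U(3)
    by (intro exI[of _ "f -` U"]) (auto simp: dense_iff_meets_open)
qed

section \<open>Operators in selected copies of the auxiliary space\<close>

text \<open>The given equations are stated on a tensor product of two or three copies of the auxiliary space.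
  They are carried over to arbitrary labels by cutting a tensor into slices: along an injective map
  \<open>\<iota>\<close> of labels, the indices in the copies outside its range are frozen, and a slice is a tensor
  over the few labels on which the equation lives. The matrices acting in the range of \<open>\<iota>\<close> act on every
  slice separately, and the slices together determine the tensor.\<close>

definition overwrite :: "('k \<Rightarrow> 'l) \<Rightarrow> ('l \<Rightarrow> 'v) \<Rightarrow> ('k \<Rightarrow> 'v) \<Rightarrow> 'l \<Rightarrow> 'v" where
  "overwrite \<iota> f h l = (if l \<in> range \<iota> then h (inv \<iota> l) else f l)"

lemma overwrite_apply: "inj \<iota> \<Longrightarrow> overwrite \<iota> f h (\<iota> i) = h i"
  by (simp add: overwrite_def)

lemma overwrite_upd:
  "inj \<iota> \<Longrightarrow> (overwrite \<iota> f h)(\<iota> i := a) = overwrite \<iota> f (h(i := a))"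
  by (auto simp: overwrite_def fun_eq_iff)

lemma overwrite_self: "inj \<iota> \<Longrightarrow> overwrite \<iota> f (f \<circ> \<iota>) = f"
  by (auto simp: overwrite_def fun_eq_iff)

definition slice :: "('k \<Rightarrow> 'l) \<Rightarrow> ('l \<Rightarrow> 'v) \<Rightarrow> ('l, 'v, 'w) tens \<Rightarrow> ('k, 'v, 'w) tens" where
  "slice \<iota> f \<psi> = (\<lambda>h. \<psi> (overwrite \<iota> f h))"

lemma slice_Rop:
  "inj \<iota> \<Longrightarrow> slice \<iota> f (Rop s X (\<iota> i) (\<iota> j) \<psi>) = Rop s X i j (slice \<iota> f \<psi>)"
  by (simp add: slice_def Rop_def overwrite_apply overwrite_upd)

lemma slice_Top:
  "inj \<iota> \<Longrightarrow> slice \<iota> f (Top A (\<iota> i) \<psi>) = Top A i (slice \<iota> f \<psi>)"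
  by (simp add: slice_def Top_def overwrite_apply overwrite_upd)

lemma eq_if_slices_eq:
  assumes "inj \<iota>" and "\<And>f. slice \<iota> f \<phi> = slice \<iota> f \<psi>"
  shows "\<phi> = \<psi>"
proof
  fix f
  have "slice \<iota> f \<phi> (f \<circ> \<iota>) = slice \<iota> f \<psi> (f \<circ> \<iota>)" using assms(2) by simp
  then show "\<phi> f = \<psi> f" by (simp add: slice_def overwrite_self[OF assms(1)])
qed

lemma Rop_sum:
  fixes s :: "complex \<Rightarrow> 'w::ab_group_add \<Rightarrow> 'w"
  assumes "vector_space s"
  shows "Rop s X i j (\<lambda>f. \<Sum>h\<in>I. F h f) = (\<lambda>f. \<Sum>h\<in>I. Rop s X i j (F h) f)"
proof
  interpret vector_space s by fact
  fix f
  have "Rop s X i j (\<lambda>f. \<Sum>h\<in>I. F h f) f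
      = (\<Sum>a\<in>UNIV. \<Sum>b\<in>UNIV. \<Sum>h\<in>I. s (X $ (f i, f j) $ (a, b)) (F h (f(i := a, j := b))))"
    by (simp add: Rop_def scale_sum_right)
  also have "\<dots> = (\<Sum>a\<in>UNIV. \<Sum>h\<in>I. \<Sum>b\<in>UNIV. s (X $ (f i, f j) $ (a, b)) (F h (f(i := a, j := b))))"
    by (intro sum.cong[OF refl] sum.swap)
  also have "\<dots> = (\<Sum>h\<in>I. \<Sum>a\<in>UNIV. \<Sum>b\<in>UNIV. s (X $ (f i, f j) $ (a, b)) (F h (f(i := a, j := b))))"
    by (rule sum.swap)
  finally show "Rop s X i j (\<lambda>f. \<Sum>h\<in>I. F h f) f = (\<Sum>h\<in>I. Rop s X i j (F h) f)"
    by (simp add: Rop_def)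
qed

lemma Rop_pure_tensor:
  fixes s :: "complex \<Rightarrow> 'w::ab_group_add \<Rightarrow> 'w"
  assumes "vector_space s"
  shows "Rop s X i j (\<lambda>f. s (\<psi> f) w) = (\<lambda>f. s (Rop (*) X i j \<psi> f) w)"
proof -
  interpret vector_space s by fact
  show ?thesis by (simp add: Rop_def scale_sum_left)
qed

lemma tens_eq_sum_pure_tensors:
  fixes s :: "complex \<Rightarrow> 'w::ab_group_add \<Rightarrow> 'w"
    and \<phi> :: "('k::finite, 'v::finite, 'w) tens"
  assumes "vector_space s"
  shows "\<phi> = (\<lambda>f. \<Sum>h\<in>UNIV. s (if h = f then 1 else 0) (\<phi> h))"
proof -
  interpret vector_space s by fact
  show ?thesis by (simp add: if_distrib[of "\<lambda>c. s c _"] cong: if_cong)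
qed

text \<open>A c-number identity holds with any quantum space attached, because the pure tensors span and
  c-number matrices do not touch the quantum factor.\<close>

lemma Rop_identity_extend_scalars:
  fixes s :: "complex \<Rightarrow> 'w::ab_group_add \<Rightarrow> 'w"
    and X1 X2 X3 Y1 Y2 Y3 :: "'v::finite mat2"
    and i1 i2 i3 j1 j2 j3 k1 k2 k3 l1 l2 l3 :: "'k::finite"
  assumes vs: "vector_space s"
    and eq: "(Rop (*) X1 i1 j1 \<circ> Rop (*) X2 i2 j2 \<circ> Rop (*) X3 i3 j3 :: ('k, 'v, complex) tens \<Rightarrow> _)
      = Rop (*) Y1 k1 l1 \<circ> Rop (*) Y2 k2 l2 \<circ> Rop (*) Y3 k3 l3"
  shows "(Rop s X1 i1 j1 \<circ> Rop s X2 i2 j2 \<circ> Rop s X3 i3 j3 :: ('k, 'v, 'w) tens \<Rightarrow> _)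
      = Rop s Y1 k1 l1 \<circ> Rop s Y2 k2 l2 \<circ> Rop s Y3 k3 l3"
proof
  fix \<phi> :: "('k, 'v, 'w) tens"
  have eq': "Rop (*) X1 i1 j1 (Rop (*) X2 i2 j2 (Rop (*) X3 i3 j3 \<psi>))
      = Rop (*) Y1 k1 l1 (Rop (*) Y2 k2 l2 (Rop (*) Y3 k3 l3 \<psi>))" for \<psi> :: "('k, 'v, complex) tens"
    using fun_cong[OF eq, of \<psi>] by simp
  show "(Rop s X1 i1 j1 \<circ> Rop s X2 i2 j2 \<circ> Rop s X3 i3 j3) \<phi>
      = (Rop s Y1 k1 l1 \<circ> Rop s Y2 k2 l2 \<circ> Rop s Y3 k3 l3) \<phi>"
    by (subst (1 2) tens_eq_sum_pure_tensors[OF vs, of \<phi>])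
       (simp only: o_apply Rop_sum[OF vs] Rop_pure_tensor[OF vs] eq')
qed

text \<open>The three matrices are independent parameters, since the same exchange relation is used at several
  choices of spectral arguments.\<close>

definition yang_baxter_at :: "(complex \<Rightarrow> 'w::ab_group_add \<Rightarrow> 'w) \<Rightarrow> 'v::finite mat2 \<Rightarrow> 'v mat2 \<Rightarrow> 'v mat2
    \<Rightarrow> 'l \<Rightarrow> 'l \<Rightarrow> 'l \<Rightarrow> bool" where
  "yang_baxter_at s A B C p q r \<longleftrightarrow>
    (Rop s A p q \<circ> Rop s B p r \<circ> Rop s C q r :: ('l, 'v, 'w) tens \<Rightarrow> _)
    = Rop s C q r \<circ> Rop s B p r \<circ> Rop s A p q"

lemma yang_baxter_at_labels:
  fixes s :: "complex \<Rightarrow> 'w::ab_group_add \<Rightarrow> 'w" and A B C :: "'v::finite mat2"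
    and p q r :: 'l
  assumes vs: "vector_space s"
    and eq: "(Rop (*) A 1 2 \<circ> Rop (*) B 1 3 \<circ> Rop (*) C 2 3 :: (3, 'v, complex) tens \<Rightarrow> _)
      = Rop (*) C 2 3 \<circ> Rop (*) B 1 3 \<circ> Rop (*) A 1 2"
    and dist: "distinct [p, q, r]"
  shows "yang_baxter_at s A B C p q r"
  unfolding yang_baxter_at_def
proof
  fix \<psi> :: "('l, 'v, 'w) tens"
  define \<iota> :: "3 \<Rightarrow> 'l" where "\<iota> i = (if i = 1 then p else if i = 2 then q else r)" for i
  have \<iota>: "p = \<iota> 1" "q = \<iota> 2" "r = \<iota> 3" by (simp_all add: \<iota>_def)
  have inj: "inj \<iota>"
    using dist by (auto simp: inj_def \<iota>_def forall_3)
  note eq_w = fun_cong[OF Rop_identity_extend_scalars[OF vs eq], unfolded o_apply]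
  show "(Rop s A p q \<circ> Rop s B p r \<circ> Rop s C q r) \<psi>
      = (Rop s C q r \<circ> Rop s B p r \<circ> Rop s A p q) \<psi>"
    by (rule eq_if_slices_eq[OF inj])
       (simp only: \<iota> o_apply slice_Rop[OF inj] eq_w)
qed

lemma reflection_labelled:
  fixes s :: "complex \<Rightarrow> 'w::ab_group_add \<Rightarrow> 'w" and A B :: "'v::finite mat2" and x y :: 'l
  assumes eq: "(Rop s A 1 2 \<circ> Top C 1 \<circ> Rop s B 2 1 \<circ> Top D 2 :: (2, 'v, 'w) tens \<Rightarrow> _)
      = Top D 2 \<circ> Rop s B 1 2 \<circ> Top C 1 \<circ> Rop s A 2 1"
    and "x \<noteq> y"
  shows "(Rop s A x y \<circ> Top C x \<circ> Rop s B y x \<circ> Top D y :: ('l, 'v, 'w) tens \<Rightarrow> _)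
      = Top D y \<circ> Rop s B x y \<circ> Top C x \<circ> Rop s A y x"
proof
  fix \<psi> :: "('l, 'v, 'w) tens"
  define \<iota> :: "2 \<Rightarrow> 'l" where "\<iota> i = (if i = 1 then x else y)" for i
  have \<iota>: "x = \<iota> 1" "y = \<iota> 2" by (simp_all add: \<iota>_def)
  have inj: "inj \<iota>"
    using \<open>x \<noteq> y\<close> by (auto simp: inj_def \<iota>_def forall_2)
  show "(Rop s A x y \<circ> Top C x \<circ> Rop s B y x \<circ> Top D y) \<psi>
      = (Top D y \<circ> Rop s B x y \<circ> Top C x \<circ> Rop s A y x) \<psi>"
    by (rule eq_if_slices_eq[OF inj])
       (simp only: \<iota> o_apply slice_Rop[OF inj] slice_Top[OF inj] fun_cong[OF eq, unfolded o_apply])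
qed

section \<open>Operators acting in disjoint sets of copies commute\<close>

lemma Rop_Rop_commute:
  fixes s :: "complex \<Rightarrow> 'w::ab_group_add \<Rightarrow> 'w"
  assumes vs: "vector_space s" and disj: "{x, y} \<inter> {x', y'} = {}"
  shows "Rop s A x y \<circ> Rop s B x' y' = Rop s B x' y' \<circ> Rop s A x y"
proof (intro ext)
  interpret vector_space s by fact
  fix \<psi> f
  have ne: "x \<noteq> x'" "x \<noteq> y'" "y \<noteq> x'" "y \<noteq> y'" "x' \<noteq> x" "y' \<noteq> x" "x' \<noteq> y" "y' \<noteq> y"
    using disj by auto
  let ?t = "\<lambda>a b c d. s (A $ (f x, f y) $ (a, b)) (s (B $ (f x', f y') $ (c, d))
        (\<psi> (f(x := a, y := b, x' := c, y' := d))))"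
  have upd: "f(x := a, y := b, x' := c, y' := d) = f(x' := c, y' := d, x := a, y := b)" for a b c d
    using disj by (auto simp: fun_eq_iff)
  have "(Rop s A x y \<circ> Rop s B x' y') \<psi> f
      = (\<Sum>(a, b)\<in>UNIV \<times> UNIV. \<Sum>(c, d)\<in>UNIV \<times> UNIV. ?t a b c d)"
    using ne by (simp add: Rop_def scale_sum_right flip: sum.cartesian_product del: UNIV_Times_UNIV)
  also have "\<dots> = (\<Sum>(c, d)\<in>UNIV \<times> UNIV. \<Sum>(a, b)\<in>UNIV \<times> UNIV. ?t a b c d)"
    unfolding case_prod_unfold by (rule sum.swap)
  also have "\<dots> = (Rop s B x' y' \<circ> Rop s A x y) \<psi> f"
    using ne by (simp add: Rop_def scale_sum_right upd mult.commute flip: sum.cartesian_product del: UNIV_Times_UNIV)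
  finally show "(Rop s A x y \<circ> Rop s B x' y') \<psi> f = (Rop s B x' y' \<circ> Rop s A x y) \<psi> f" .
qed

lemma Top_Rop_commute:
  fixes s :: "complex \<Rightarrow> 'w::ab_group_add \<Rightarrow> 'w"
  assumes vs: "vector_space s" and lin: "\<And>a b. Vector_Spaces.linear s s (A a b)"
    and disj: "x \<notin> {y, z}"
  shows "Top A x \<circ> Rop s B y z = Rop s B y z \<circ> Top A x"
proof (intro ext)
  interpret vector_space s by fact
  fix \<psi> f
  let ?t = "\<lambda>a c d. s (B $ (f y, f z) $ (c, d)) (A (f x) a (\<psi> (f(x := a, y := c, z := d))))"
  have ne: "y \<noteq> x" "z \<noteq> x" "x \<noteq> y" "x \<noteq> z" using disj by auto
  note hom = Vector_Spaces.linear.axioms(3)[OF lin]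
  have upd: "f(x := a, y := c, z := d) = f(y := c, z := d, x := a)" for a c d
    using disj by (auto simp: fun_eq_iff)
  have "(Top A x \<circ> Rop s B y z) \<psi> f = (\<Sum>a\<in>UNIV. \<Sum>(c, d)\<in>UNIV \<times> UNIV. ?t a c d)"
    using ne by (simp add: Rop_def Top_def module_hom.sum[OF hom] module_hom.scale[OF hom]
        flip: sum.cartesian_product del: UNIV_Times_UNIV)
  also have "\<dots> = (\<Sum>(c, d)\<in>UNIV \<times> UNIV. \<Sum>a\<in>UNIV. ?t a c d)"
    unfolding case_prod_unfold by (rule sum.swap)
  also have "\<dots> = (Rop s B y z \<circ> Top A x) \<psi> f"
    using ne by (simp add: Rop_def Top_def scale_sum_right upd flip: sum.cartesian_product del: UNIV_Times_UNIV)
  finally show "(Top A x \<circ> Rop s B y z) \<psi> f = (Rop s B y z \<circ> Top A x) \<psi> f" .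
qed

lemma op_prod_simps [simp]:
  "op_prod [] = id"
  "op_prod (f # fs) = f \<circ> op_prod fs"
  "op_prod (fs @ gs) = op_prod fs \<circ> op_prod gs"
  by (simp_all add: op_prod_def, induction fs) (simp_all add: comp_assoc)

lemma op_prod_commute:
  assumes "\<And>f. f \<in> set fs \<Longrightarrow> f \<circ> g = g \<circ> f"
  shows "op_prod fs \<circ> g = g \<circ> op_prod fs"
  using assms
proof (induction fs)
  case (Cons f fs)
  have comm: "f \<circ> g = g \<circ> f" and IH: "op_prod fs \<circ> g = g \<circ> op_prod fs"
    using Cons.IH[OF Cons.prems] Cons.prems[of f] by (simp_all only: list.set_intros)
  have "op_prod (f # fs) \<circ> g = f \<circ> (op_prod fs \<circ> g)"
    by (simp add: comp_assoc)
  also have "\<dots> = (f \<circ> g) \<circ> op_prod fs"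
    by (simp only: IH comp_assoc)
  also have "\<dots> = g \<circ> op_prod (f # fs)"
    by (simp only: comm op_prod_simps comp_assoc)
  finally show ?case .
qed simp

lemma Rop_fusedR_commute:
  fixes s :: "complex \<Rightarrow> 'w::ab_group_add \<Rightarrow> 'w"
  assumes "vector_space s" and "{x, y} \<inter> (set X \<union> set Y) = {}"
  shows "Rop s A x y \<circ> fusedR s R \<alpha> X Y = fusedR s R \<alpha> X Y \<circ> Rop s A x y"
  unfolding fusedR_def
  by (rule sym, rule op_prod_commute) (use assms(2) in \<open>auto intro!: Rop_Rop_commute[OF assms(1)]\<close>)

lemma fusedR_fusedR_commute:
  fixes s :: "complex \<Rightarrow> 'w::ab_group_add \<Rightarrow> 'w"
  assumes "vector_space s" and "(set X \<union> set Y) \<inter> (set X' \<union> set Y') = {}"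
  shows "fusedR s R \<alpha> X Y \<circ> fusedR s R \<beta> X' Y' = fusedR s R \<beta> X' Y' \<circ> fusedR s R \<alpha> X Y"
  unfolding fusedR_def[of s R \<alpha>]
  by (rule op_prod_commute) (use assms(2) in \<open>auto intro!: Rop_fusedR_commute[OF assms(1)]\<close>)

lemma fusedT_fusedR_commute:
  fixes s :: "complex \<Rightarrow> 'w::ab_group_add \<Rightarrow> 'w" and X :: "'l::finite list"
  assumes vs: "vector_space s" and lin: "\<And>u a b. Vector_Spaces.linear s s (T u a b)"
    and "set Z \<inter> (set X \<union> set Y) = {}"
  shows "fusedT s R T lam Z \<circ> fusedR s R \<alpha> X Y = fusedR s R \<alpha> X Y \<circ> fusedT s R T lam Z"
  using assms(3)
proof (induction Z)
  case (Cons z Z)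
  let ?F = "fusedR s R \<alpha> X Y" and ?P = "op_prod [Rop s (R (lam $ z + lam $ y)) y z. y \<leftarrow> Z]"
  have T: "Top (T (lam $ z)) z \<circ> ?F = ?F \<circ> Top (T (lam $ z)) z"
    unfolding fusedR_def by (rule sym, rule op_prod_commute)
      (use Cons.prems in \<open>auto intro!: Top_Rop_commute[OF vs lin, symmetric]\<close>)
  have P: "?P \<circ> ?F = ?F \<circ> ?P"
    by (rule op_prod_commute) (use Cons.prems in \<open>auto intro!: Rop_fusedR_commute[OF vs]\<close>)
  have IH: "fusedT s R T lam Z \<circ> ?F = ?F \<circ> fusedT s R T lam Z"
    by (rule Cons.IH) (use Cons.prems in auto)
  show ?case
    by (simp only: fusedT.simps comp_assoc IH) (simp only: rewriteL_comp_comp[OF P] rewriteL_comp_comp[OF T] comp_assoc)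
qed simp

section \<open>Fusion of the Yang--Baxter equation\<close>

lemma fusedR_Nil_left [simp]: "fusedR s R \<alpha> [] Y = id"
  by (induction Y) (simp_all add: fusedR_def)

lemma fusedR_Nil_right [simp]: "fusedR s R \<alpha> X [] = id"
  by (simp add: fusedR_def)

lemma fusedR_single: "fusedR s R \<alpha> [x] [y] = Rop s (R (\<alpha> x y)) x y"
  by (simp add: fusedR_def)

lemma fusedR_append_right:
  "fusedR s R \<alpha> X (Y @ Z) = fusedR s R \<alpha> X Y \<circ> fusedR s R \<alpha> X Z"
  by (simp add: fusedR_def)

lemma fusedR_Cons_right:
  "fusedR s R \<alpha> X (y # Y) = fusedR s R \<alpha> X [y] \<circ> fusedR s R \<alpha> X Y"
  using fusedR_append_right[of s R \<alpha> X "[y]" Y] by simp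

lemma fusedR_append_single:
  "fusedR s R \<alpha> (X @ Z) [y] = fusedR s R \<alpha> X [y] \<circ> fusedR s R \<alpha> Z [y]"
  by (simp add: fusedR_def)

text \<open>The first label runs fastest, so the factors of \<open>X @ Z\<close> are interleaved column by column. Separating
  them moves factors of \<open>Z\<close> with an earlier label of \<open>Y\<close> to the right of factors of \<open>X\<close> with a later
  one, and these share no label.\<close>

lemma fusedR_append_left:
  fixes s :: "complex \<Rightarrow> 'w::ab_group_add \<Rightarrow> 'w"
  assumes vs: "vector_space s" and "distinct Y" and "set X \<inter> set Z = {}"
    and "(set X \<union> set Z) \<inter> set Y = {}"
  shows "fusedR s R \<alpha> (X @ Z) Y = fusedR s R \<alpha> X Y \<circ> fusedR s R \<alpha> Z Y"
  using assms(2,4)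
proof (induction Y)
  case (Cons y Y)
  have IH: "fusedR s R \<alpha> (X @ Z) Y = fusedR s R \<alpha> X Y \<circ> fusedR s R \<alpha> Z Y"
    by (rule Cons.IH) (use Cons.prems in auto)
  have comm: "fusedR s R \<alpha> Z [y] \<circ> fusedR s R \<alpha> X Y = fusedR s R \<alpha> X Y \<circ> fusedR s R \<alpha> Z [y]"
    by (rule fusedR_fusedR_commute[OF vs]) (use Cons.prems assms(3) in auto)
  have "fusedR s R \<alpha> (X @ Z) (y # Y)
      = fusedR s R \<alpha> X [y] \<circ> fusedR s R \<alpha> Z [y] \<circ> (fusedR s R \<alpha> X Y \<circ> fusedR s R \<alpha> Z Y)"
    by (simp only: fusedR_Cons_right[of s R \<alpha> _ y Y] fusedR_append_single IH)
  also have "\<dots> = fusedR s R \<alpha> X [y] \<circ> (fusedR s R \<alpha> X Y \<circ> fusedR s R \<alpha> Z [y]) \<circ> fusedR s R \<alpha> Z Y"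
    by (simp only: comp_assoc rewriteL_comp_comp[OF comm])
  also have "\<dots> = fusedR s R \<alpha> X (y # Y) \<circ> fusedR s R \<alpha> Z (y # Y)"
    by (simp add: fusedR_Cons_right[of s R \<alpha> _ y Y] comp_assoc)
  finally show ?case .
qed simp

text \<open>In the step, \<open>R\<^sub>X\<^sub>q R\<^sub>X\<^sub>r R\<^sub>q\<^sub>r\<close> is moved through by the induction hypothesis and \<open>R\<^sub>p\<^sub>q R\<^sub>p\<^sub>r R\<^sub>q\<^sub>r\<close> by the unfused
  equation. The two triples can be separated, and merged again, because \<open>R\<^sub>p\<^sub>r\<close> and \<open>R\<^sub>X\<^sub>q\<close> share no label,
  and neither do \<open>R\<^sub>p\<^sub>q\<close> and \<open>R\<^sub>X\<^sub>r\<close>.\<close>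

lemma yang_baxter_fused_first:
  fixes s :: "complex \<Rightarrow> 'w::ab_group_add \<Rightarrow> 'w"
  assumes vs: "vector_space s"
    and yb: "\<And>p. p \<in> set X \<Longrightarrow>
      yang_baxter_at s (R (\<alpha> p q)) (R (\<gamma> p r)) (R (\<beta> q r)) p q r"
    and "distinct X" and "q \<noteq> r" and "{q, r} \<inter> set X = {}"
  shows "fusedR s R \<alpha> X [q] \<circ> fusedR s R \<gamma> X [r] \<circ> fusedR s R \<beta> [q] [r]
    = fusedR s R \<beta> [q] [r] \<circ> fusedR s R \<gamma> X [r] \<circ> fusedR s R \<alpha> X [q]"
  using yb assms(3,5)
proof (induction X)
  case (Cons p X)
  let ?A = "fusedR s R \<alpha> [p] [q]" and ?C = "fusedR s R \<gamma> [p] [r]" and ?B = "fusedR s R \<beta> [q] [r]"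
  let ?AX = "fusedR s R \<alpha> X [q]" and ?CX = "fusedR s R \<gamma> X [r]"
  have split: "fusedR s R \<alpha> (p # X) [q] = ?A \<circ> ?AX" "fusedR s R \<gamma> (p # X) [r] = ?C \<circ> ?CX"
    using fusedR_append_single[of s R _ "[p]" X] by simp_all
  have IH: "?AX \<circ> ?CX \<circ> ?B = ?B \<circ> ?CX \<circ> ?AX"
    by (rule Cons.IH) (use Cons.prems in auto)
  have single: "?A \<circ> ?C \<circ> ?B = ?B \<circ> ?C \<circ> ?A"
    using Cons.prems(1)[of p] by (simp add: fusedR_single yang_baxter_at_def)
  have comm_AC: "?AX \<circ> ?C = ?C \<circ> ?AX" and comm_CA: "?A \<circ> ?CX = ?CX \<circ> ?A"
    by (rule fusedR_fusedR_commute[OF vs]; use Cons.prems assms(4) in auto)+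
  have "?A \<circ> ?AX \<circ> (?C \<circ> ?CX) \<circ> ?B = ?A \<circ> ?C \<circ> (?AX \<circ> ?CX \<circ> ?B)"
    by (simp only: comp_assoc rewriteL_comp_comp[OF comm_AC])
  also have "\<dots> = (?A \<circ> ?C \<circ> ?B) \<circ> ?CX \<circ> ?AX"
    by (simp only: IH) (simp only: comp_assoc)
  also have "\<dots> = ?B \<circ> (?C \<circ> ?CX) \<circ> (?A \<circ> ?AX)"
    by (simp only: single) (simp only: comp_assoc rewriteL_comp_comp[OF comm_CA])
  finally show ?case by (simp only: split)
qed simp

text \<open>The labels of the third slot occur only as second index, so both products over \<open>Z\<close> run in the same
  order, and the labels of \<open>Z\<close> can be treated one after another.\<close>

lemma yang_baxter_fused_third:
  fixes s :: "complex \<Rightarrow> 'w::ab_group_add \<Rightarrow> 'w"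
  assumes vs: "vector_space s"
    and yb: "\<And>p r. p \<in> set X \<Longrightarrow> r \<in> set Z \<Longrightarrow>
      yang_baxter_at s (R (\<alpha> p q)) (R (\<gamma> p r)) (R (\<beta> q r)) p q r"
    and "distinct X" and "distinct Z" and "q \<notin> set X \<union> set Z" and "set X \<inter> set Z = {}"
  shows "fusedR s R \<alpha> X [q] \<circ> fusedR s R \<gamma> X Z \<circ> fusedR s R \<beta> [q] Z
    = fusedR s R \<beta> [q] Z \<circ> fusedR s R \<gamma> X Z \<circ> fusedR s R \<alpha> X [q]"
  using yb assms(4-6)
proof (induction Z)
  case (Cons z Z)
  let ?A = "fusedR s R \<alpha> X [q]" and ?C = "fusedR s R \<gamma> X [z]" and ?B = "fusedR s R \<beta> [q] [z]"
  let ?CZ = "fusedR s R \<gamma> X Z" and ?BZ = "fusedR s R \<beta> [q] Z"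
  note split = fusedR_Cons_right[of s R _ _ z Z]
  have IH: "?A \<circ> ?CZ \<circ> ?BZ = ?BZ \<circ> ?CZ \<circ> ?A"
    by (rule Cons.IH) (use Cons.prems in auto)
  have single: "?A \<circ> ?C \<circ> ?B = ?B \<circ> ?C \<circ> ?A"
    by (rule yang_baxter_fused_first[OF vs]) (use Cons.prems assms(3) in auto)
  have comm_CB: "?CZ \<circ> ?B = ?B \<circ> ?CZ" and comm_BC: "?C \<circ> ?BZ = ?BZ \<circ> ?C"
    by (rule fusedR_fusedR_commute[OF vs]; use Cons.prems in auto)+
  have "?A \<circ> (?C \<circ> ?CZ) \<circ> (?B \<circ> ?BZ) = (?A \<circ> ?C \<circ> ?B) \<circ> ?CZ \<circ> ?BZ"
    by (simp only: comp_assoc rewriteL_comp_comp[OF comm_CB])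
  also have "\<dots> = ?B \<circ> ?C \<circ> (?A \<circ> ?CZ \<circ> ?BZ)"
    by (simp only: single) (simp only: comp_assoc)
  also have "\<dots> = ?B \<circ> ?BZ \<circ> (?C \<circ> ?CZ) \<circ> ?A"
    by (simp only: IH) (simp only: comp_assoc rewriteL_comp_comp[OF comm_BC])
  finally show ?case by (simp only: split)
qed simp

text \<open>The labels of the middle slot occur as first index in one factor and as second index in another. The
  last label of \<open>Y\<close> is the innermost in \<open>R\<^sub>Y\<^sub>r\<close> and must be the first to meet its partner, which forces the
  reversed order in \<open>R\<^sub>X\<^sub>Y\<close>. This is the origin of the reversed list in the generalized reflection equation.\<close>

lemma yang_baxter_fused_second:
  fixes s :: "complex \<Rightarrow> 'w::ab_group_add \<Rightarrow> 'w"
  assumes vs: "vector_space s"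
    and yb: "\<And>p q. p \<in> set X \<Longrightarrow> q \<in> set Y \<Longrightarrow>
      yang_baxter_at s (R (\<alpha> p q)) (R (\<gamma> p r)) (R (\<beta> q r)) p q r"
    and "distinct X" and "distinct Y" and "r \<notin> set X \<union> set Y" and "set X \<inter> set Y = {}"
  shows "fusedR s R \<beta> Y [r] \<circ> fusedR s R \<gamma> X [r] \<circ> fusedR s R \<alpha> X (rev Y)
    = fusedR s R \<alpha> X (rev Y) \<circ> fusedR s R \<gamma> X [r] \<circ> fusedR s R \<beta> Y [r]"
  using yb assms(4-6)
proof (induction Y)
  case (Cons y Y)
  let ?B = "fusedR s R \<beta> [y] [r]" and ?C = "fusedR s R \<gamma> X [r]" and ?A = "fusedR s R \<alpha> X [y]"
  let ?BY = "fusedR s R \<beta> Y [r]" and ?AY = "fusedR s R \<alpha> X (rev Y)"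
  have split: "fusedR s R \<beta> (y # Y) [r] = ?B \<circ> ?BY" "fusedR s R \<alpha> X (rev (y # Y)) = ?AY \<circ> ?A"
    using fusedR_append_single[of s R _ "[y]" Y] by (simp_all add: fusedR_append_right)
  have IH: "?BY \<circ> ?C \<circ> ?AY = ?AY \<circ> ?C \<circ> ?BY"
    by (rule Cons.IH) (use Cons.prems in auto)
  have single: "?A \<circ> ?C \<circ> ?B = ?B \<circ> ?C \<circ> ?A"
    by (rule yang_baxter_fused_first[OF vs]) (use Cons.prems assms(3) in auto)
  have comm_BA: "?BY \<circ> ?A = ?A \<circ> ?BY" and comm_AB: "?B \<circ> ?AY = ?AY \<circ> ?B"
    by (rule fusedR_fusedR_commute[OF vs]; use Cons.prems in auto)+
  have "?B \<circ> ?BY \<circ> ?C \<circ> (?AY \<circ> ?A) = ?B \<circ> (?BY \<circ> ?C \<circ> ?AY) \<circ> ?A"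
    by (simp only: comp_assoc)
  also have "\<dots> = ?AY \<circ> (?B \<circ> ?C \<circ> ?A) \<circ> ?BY"
    by (simp only: IH) (simp only: comp_assoc comm_BA rewriteL_comp_comp[OF comm_AB])
  also have "\<dots> = ?AY \<circ> ?A \<circ> ?C \<circ> (?B \<circ> ?BY)"
    by (simp only: single[symmetric]) (simp only: comp_assoc)
  finally show ?case by (simp only: split)
qed simp

section \<open>Fusion of the reflection equation\<close>

text \<open>The parameter values at which every exchange relation between two or three labels holds. The
  Yang--Baxter equation is needed at two pairs of arguments \<open>(\<lambda>\<^sub>1, \<lambda>\<^sub>2)\<close>, namely \<open>(\<lambda>\<^sub>p + \<lambda>\<^sub>r, \<lambda>\<^sub>q + \<lambda>\<^sub>r)\<close> and
  \<open>(\<lambda>\<^sub>p + \<lambda>\<^sub>r, \<lambda>\<^sub>r - \<lambda>\<^sub>q)\<close>: these are the choices for which all three factors depend on a sum or a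
  difference of two parameters and just one of them on a difference.\<close>

locale exchange_point =
  fixes s :: "complex \<Rightarrow> 'w::ab_group_add \<Rightarrow> 'w"
    and R :: "complex \<Rightarrow> 'v::finite mat2"
    and T :: "complex \<Rightarrow> 'v \<Rightarrow> 'v \<Rightarrow> 'w \<Rightarrow> 'w"
    and lam :: "complex ^ 'l::finite"
  assumes vector_space: "vector_space s"
    and entries_linear: "\<And>u a b. Vector_Spaces.linear s s (T u a b)"
    and yang_baxter_diff: "\<And>p q r. distinct [p, q, r] \<Longrightarrow>
      yang_baxter_at s (R (lam $ p - lam $ q)) (R (lam $ p + lam $ r)) (R (lam $ q + lam $ r)) p q r"
    and yang_baxter_sum: "\<And>p q r. distinct [p, q, r] \<Longrightarrow>
      yang_baxter_at s (R (lam $ p + lam $ q)) (R (lam $ p + lam $ r)) (R (lam $ r - lam $ q)) p q r"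
    and reflection: "\<And>x y. x \<noteq> y \<Longrightarrow>
      (Rop s (R (lam $ x - lam $ y)) x y \<circ> Top (T (lam $ x)) x \<circ> Rop s (R (lam $ x + lam $ y)) y x
        \<circ> Top (T (lam $ y)) y :: ('l, 'v, 'w) tens \<Rightarrow> _)
      = Top (T (lam $ y)) y \<circ> Rop s (R (lam $ x + lam $ y)) x y \<circ> Top (T (lam $ x)) x
        \<circ> Rop s (R (lam $ x - lam $ y)) y x"
begin

abbreviation R_plus :: "'l list \<Rightarrow> 'l list \<Rightarrow> ('l, 'v, 'w) tens \<Rightarrow> ('l, 'v, 'w) tens" where
  "R_plus \<equiv> fusedR s R (\<lambda>x y. lam $ x + lam $ y)"

abbreviation R_left_minus_right :: "'l list \<Rightarrow> 'l list \<Rightarrow> ('l, 'v, 'w) tens \<Rightarrow> ('l, 'v, 'w) tens" where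
  "R_left_minus_right \<equiv> fusedR s R (\<lambda>x y. lam $ x - lam $ y)"

abbreviation R_right_minus_left :: "'l list \<Rightarrow> 'l list \<Rightarrow> ('l, 'v, 'w) tens \<Rightarrow> ('l, 'v, 'w) tens" where
  "R_right_minus_left \<equiv> fusedR s R (\<lambda>x y. lam $ y - lam $ x)"

abbreviation T_fused :: "'l list \<Rightarrow> ('l, 'v, 'w) tens \<Rightarrow> ('l, 'v, 'w) tens" where
  "T_fused \<equiv> fusedT s R T lam"

lemmas T_R_commute = fusedT_fusedR_commute[where T = T, OF vector_space entries_linear]

lemma T_fused_single: "T_fused [x] = Top (T (lam $ x)) x"
  by simp

lemma T_fused_Cons: "T_fused (x # X) = T_fused [x] \<circ> R_plus X [x] \<circ> T_fused X"
  by (simp add: fusedR_def add.commute)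

text \<open>This is the reflection equation with the two labels interchanged and read from right to left.\<close>

lemma reflection_single_single:
  assumes "x \<noteq> z"
  shows "T_fused [x] \<circ> R_plus [z] [x] \<circ> T_fused [z] \<circ> R_right_minus_left [x] [z]
    = R_left_minus_right [z] [x] \<circ> T_fused [z] \<circ> R_plus [x] [z] \<circ> T_fused [x]"
  using reflection[OF assms[symmetric]]
  by (simp only: T_fused_single fusedR_single add.commute[of "lam $ x"])

text \<open>The step moves \<open>T\<^sub>x\<close> past \<open>T\<^sub>z\<close> and leaves the rest of the list to the induction hypothesis. The fused
  Yang--Baxter equation is used twice: to bring \<open>R\<^sub>x\<^sub>z\<close> next to \<open>T\<^sub>z\<close> beforehand, and afterwards to
  collect the differences on the left and the sums on the right.\<close>

lemma reflection_single:
  assumes "x \<notin> set Z" and "distinct Z"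
  shows "T_fused [x] \<circ> R_plus Z [x] \<circ> T_fused Z \<circ> R_right_minus_left [x] Z
    = R_left_minus_right Z [x] \<circ> T_fused Z \<circ> R_plus [x] Z \<circ> T_fused [x]"
  using assms
proof (induction Z)
  case (Cons z Z)
  let ?Tx = "T_fused [x]" and ?Tz = "T_fused [z]" and ?TZ = "T_fused Z"
  let ?Pzx = "R_plus [z] [x]" and ?PZx = "R_plus Z [x]" and ?PZz = "R_plus Z [z]"
  let ?Pxz = "R_plus [x] [z]" and ?PxZ = "R_plus [x] Z"
  let ?Dxz = "R_right_minus_left [x] [z]" and ?DxZ = "R_right_minus_left [x] Z"
  let ?Ezx = "R_left_minus_right [z] [x]" and ?EZx = "R_left_minus_right Z [x]"
  have split: "fusedR s R \<alpha> (z # Z) [x] = fusedR s R \<alpha> [z] [x] \<circ> fusedR s R \<alpha> Z [x]"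
    "fusedR s R \<alpha> [x] (z # Z) = fusedR s R \<alpha> [x] [z] \<circ> fusedR s R \<alpha> [x] Z" for \<alpha>
    using fusedR_append_single[of s R \<alpha> "[z]" Z x] fusedR_append_right[of s R \<alpha> "[x]" "[z]" Z] by simp_all
  have IH: "?Tx \<circ> ?PZx \<circ> ?TZ \<circ> ?DxZ = ?EZx \<circ> ?TZ \<circ> ?PxZ \<circ> ?Tx"
    by (rule Cons.IH) (use Cons.prems in auto)
  have yb_PPD: "?PZx \<circ> ?PZz \<circ> ?Dxz = ?Dxz \<circ> ?PZz \<circ> ?PZx"
    by (rule yang_baxter_fused_first[OF vector_space]) (use Cons.prems in \<open>auto intro!: yang_baxter_sum\<close>)
  have yb_EPP: "?EZx \<circ> ?PZz \<circ> ?Pxz = ?Pxz \<circ> ?PZz \<circ> ?EZx"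
    by (rule yang_baxter_fused_first[OF vector_space]) (use Cons.prems in \<open>auto intro!: yang_baxter_diff\<close>)
  have single: "?Tx \<circ> ?Pzx \<circ> ?Tz \<circ> ?Dxz = ?Ezx \<circ> ?Tz \<circ> ?Pxz \<circ> ?Tx"
    by (rule reflection_single_single) (use Cons.prems in auto)
  have comm: "?Tz \<circ> ?PZx = ?PZx \<circ> ?Tz" "?TZ \<circ> ?Dxz = ?Dxz \<circ> ?TZ" "?Tx \<circ> ?PZz = ?PZz \<circ> ?Tx"
    "?Tz \<circ> ?EZx = ?EZx \<circ> ?Tz" "?TZ \<circ> ?Pxz = ?Pxz \<circ> ?TZ"
    by (rule T_R_commute; use Cons.prems in auto)+
  have "?Tx \<circ> (?Pzx \<circ> ?PZx) \<circ> (?Tz \<circ> ?PZz \<circ> ?TZ) \<circ> (?Dxz \<circ> ?DxZ)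
      = ?Tx \<circ> ?Pzx \<circ> ?Tz \<circ> (?PZx \<circ> ?PZz \<circ> ?Dxz) \<circ> ?TZ \<circ> ?DxZ"
    by (simp only: comp_assoc comm rewriteL_comp_comp[OF comm(1)] rewriteL_comp_comp[OF comm(2)])
  also have "\<dots> = (?Tx \<circ> ?Pzx \<circ> ?Tz \<circ> ?Dxz) \<circ> ?PZz \<circ> ?PZx \<circ> ?TZ \<circ> ?DxZ"
    by (simp only: yb_PPD) (simp only: comp_assoc)
  also have "\<dots> = ?Ezx \<circ> ?Tz \<circ> ?Pxz \<circ> ?PZz \<circ> (?Tx \<circ> ?PZx \<circ> ?TZ \<circ> ?DxZ)"
    by (simp only: single) (simp only: comp_assoc rewriteL_comp_comp[OF comm(3)])
  also have "\<dots> = ?Ezx \<circ> ?Tz \<circ> (?Pxz \<circ> ?PZz \<circ> ?EZx) \<circ> ?TZ \<circ> ?PxZ \<circ> ?Tx"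
    by (simp only: IH) (simp only: comp_assoc)
  also have "\<dots> = (?Ezx \<circ> ?EZx) \<circ> (?Tz \<circ> ?PZz \<circ> ?TZ) \<circ> (?Pxz \<circ> ?PxZ) \<circ> ?Tx"
    by (simp only: yb_EPP[symmetric])
       (simp only: comp_assoc rewriteL_comp_comp[OF comm(4)] rewriteL_comp_comp[OF comm(5)])
  finally show ?case by (simp only: split T_fused_Cons[of z Z])
qed simp

text \<open>Splitting off the first label of \<open>X\<close>, the induction hypothesis exchanges the rest of \<open>X\<close> with \<open>Z\<close>. The
  factors \<open>R\<^sub>X\<^sub>x\<close> inside the fused \<open>T\<close> are then carried across from left to right by the two fused
  Yang--Baxter equations, which frees \<open>T\<^sub>x\<close> for the case of a single label.\<close>

lemma reflection_fused:
  assumes "distinct X" and "distinct Z" and "set X \<inter> set Z = {}"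
  shows "T_fused X \<circ> R_plus Z X \<circ> T_fused Z \<circ> R_right_minus_left (rev X) Z
    = R_left_minus_right Z (rev X) \<circ> T_fused Z \<circ> R_plus X Z \<circ> T_fused X"
  using assms
proof (induction X)
  case (Cons x X)
  let ?Tx = "T_fused [x]" and ?TX = "T_fused X" and ?TZ = "T_fused Z"
  let ?PXx = "R_plus X [x]" and ?PZx = "R_plus Z [x]" and ?PZX = "R_plus Z X"
  let ?PxZ = "R_plus [x] Z" and ?PXZ = "R_plus X Z"
  let ?DXZ = "R_right_minus_left (rev X) Z" and ?DxZ = "R_right_minus_left [x] Z"
  let ?EZX = "R_left_minus_right Z (rev X)" and ?EZx = "R_left_minus_right Z [x]"
  have split: "R_plus Z (x # X) = ?PZx \<circ> ?PZX" "R_plus (x # X) Z = ?PxZ \<circ> ?PXZ"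
    "R_right_minus_left (rev (x # X)) Z = ?DXZ \<circ> ?DxZ"
    "R_left_minus_right Z (rev (x # X)) = ?EZX \<circ> ?EZx"
    using Cons.prems fusedR_append_right[of s R _ Z "[x]" X]
      fusedR_append_left[OF vector_space, of Z "[x]" X]
      fusedR_append_left[OF vector_space, of Z "rev X" "[x]"]
    by (simp_all add: fusedR_append_right)
  have IH: "?TX \<circ> ?PZX \<circ> ?TZ \<circ> ?DXZ = ?EZX \<circ> ?TZ \<circ> ?PXZ \<circ> ?TX"
    by (rule Cons.IH) (use Cons.prems in auto)
  have yb_PPE: "?PXx \<circ> ?PZx \<circ> ?EZX = ?EZX \<circ> ?PZx \<circ> ?PXx"
    by (rule yang_baxter_fused_second[OF vector_space]) (use Cons.prems in \<open>auto intro!: yang_baxter_diff\<close>)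
  have yb_PPD: "?PXx \<circ> ?PXZ \<circ> ?DxZ = ?DxZ \<circ> ?PXZ \<circ> ?PXx"
    by (rule yang_baxter_fused_third[OF vector_space]) (use Cons.prems in \<open>auto intro!: yang_baxter_sum\<close>)
  have single: "?Tx \<circ> ?PZx \<circ> ?TZ \<circ> ?DxZ = ?EZx \<circ> ?TZ \<circ> ?PxZ \<circ> ?Tx"
    by (rule reflection_single) (use Cons.prems in auto)
  have comm: "?TX \<circ> ?PZx = ?PZx \<circ> ?TX" "?Tx \<circ> ?EZX = ?EZX \<circ> ?Tx" "?TZ \<circ> ?PXx = ?PXx \<circ> ?TZ"
    "?TX \<circ> ?DxZ = ?DxZ \<circ> ?TX" "?Tx \<circ> ?PXZ = ?PXZ \<circ> ?Tx"
    by (rule T_R_commute; use Cons.prems in auto)+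
  have "(?Tx \<circ> ?PXx \<circ> ?TX) \<circ> (?PZx \<circ> ?PZX) \<circ> ?TZ \<circ> (?DXZ \<circ> ?DxZ)
      = ?Tx \<circ> ?PXx \<circ> ?PZx \<circ> (?TX \<circ> ?PZX \<circ> ?TZ \<circ> ?DXZ) \<circ> ?DxZ"
    by (simp only: comp_assoc rewriteL_comp_comp[OF comm(1)])
  also have "\<dots> = ?Tx \<circ> (?PXx \<circ> ?PZx \<circ> ?EZX) \<circ> ?TZ \<circ> ?PXZ \<circ> ?TX \<circ> ?DxZ"
    by (simp only: IH) (simp only: comp_assoc)
  also have "\<dots> = ?EZX \<circ> ?Tx \<circ> ?PZx \<circ> ?TZ \<circ> (?PXx \<circ> ?PXZ \<circ> ?DxZ) \<circ> ?TX"
    by (simp only: yb_PPE)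
       (simp only: comp_assoc comm(4) rewriteL_comp_comp[OF comm(2)] rewriteL_comp_comp[OF comm(3)])
  also have "\<dots> = ?EZX \<circ> (?Tx \<circ> ?PZx \<circ> ?TZ \<circ> ?DxZ) \<circ> ?PXZ \<circ> ?PXx \<circ> ?TX"
    by (simp only: yb_PPD) (simp only: comp_assoc)
  also have "\<dots> = (?EZX \<circ> ?EZx) \<circ> ?TZ \<circ> (?PxZ \<circ> ?PXZ) \<circ> (?Tx \<circ> ?PXx \<circ> ?TX)"
    by (simp only: single) (simp only: comp_assoc rewriteL_comp_comp[OF comm(5)])
  finally show ?case by (simp only: split T_fused_Cons[of x X])
qed simp

end

lemma generic_two_parameters:
  fixes P :: "complex \<times> complex \<Rightarrow> bool" and f :: "complex ^ 'l::finite \<Rightarrow> complex \<times> complex"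
  assumes "generic P" and "linear f" and "\<And>a b. \<exists>lam. f lam = (a, b)"
  shows "generic (\<lambda>lam. P (f lam))"
  using assms(1,2)
proof (rule generic_linear_preimage)
  show "surj f"
    unfolding surj_def using assms(3) by (metis surj_pair)
qed

lemma generic_exchange_point:
  fixes s :: "complex \<Rightarrow> 'w::ab_group_add \<Rightarrow> 'w"
    and R :: "complex \<Rightarrow> 'v::finite mat2"
    and T :: "complex \<Rightarrow> 'v \<Rightarrow> 'v \<Rightarrow> 'w \<Rightarrow> 'w"
  assumes vs: "vector_space s"
    and lin: "\<And>u a b. Vector_Spaces.linear s s (T u a b)"
    and yb: "yang_baxter R"
    and re: "reflection_equation s R T"
  shows "generic (\<lambda>lam :: complex ^ 'l::finite. exchange_point s R T lam)"
proof -
  have yb': "generic (\<lambda>l. \<forall>p q r :: 'l. distinct [p, q, r] \<longrightarrow>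
      yang_baxter_at s (R (fst l - snd l)) (R (fst l)) (R (snd l)) p q r)"
    by (rule generic_mono[OF yb[unfolded yang_baxter_def]])
       (auto intro!: yang_baxter_at_labels[OF vs])
  have yb_at: "generic (\<lambda>l. yang_baxter_at s (R (fst l - snd l)) (R (fst l)) (R (snd l)) p q r)"
    if "distinct [p, q, r]" for p q r :: 'l
    by (rule generic_mono[OF yb']) (use that in blast)
  have diff: "generic (\<lambda>lam :: complex ^ 'l. yang_baxter_at s (R (lam $ p - lam $ q))
      (R (lam $ p + lam $ r)) (R (lam $ q + lam $ r)) p q r)" if d: "distinct [p, q, r]" for p q r
  proof -
    let ?Q = "\<lambda>l. yang_baxter_at s (R (fst l - snd l)) (R (fst l)) (R (snd l)) p q r"
    let ?f = "\<lambda>lam :: complex ^ 'l. (lam $ p + lam $ r, lam $ q + lam $ r)"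
    have "\<exists>lam. ?f lam = (a, b)" for a b
      using d by (intro exI[of _ "\<chi> i. if i = p then a else if i = q then b else 0"]) auto
    then have "generic (\<lambda>lam. ?Q (?f lam))"
      by (intro generic_two_parameters[OF yb_at[OF d]] linearI) (simp_all add: algebra_simps)
    then show ?thesis by simp
  qed
  have sum: "generic (\<lambda>lam :: complex ^ 'l. yang_baxter_at s (R (lam $ p + lam $ q))
      (R (lam $ p + lam $ r)) (R (lam $ r - lam $ q)) p q r)" if d: "distinct [p, q, r]" for p q r
  proof -
    let ?Q = "\<lambda>l. yang_baxter_at s (R (fst l - snd l)) (R (fst l)) (R (snd l)) p q r"
    let ?f = "\<lambda>lam :: complex ^ 'l. (lam $ p + lam $ r, lam $ r - lam $ q)"
    have "\<exists>lam. ?f lam = (a, b)" for a b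
      using d by (intro exI[of _ "\<chi> i. if i = p then a else if i = q then - b else 0"]) auto
    then have "generic (\<lambda>lam. ?Q (?f lam))"
      by (intro generic_two_parameters[OF yb_at[OF d]] linearI) (simp_all add: algebra_simps)
    then show ?thesis by simp
  qed
  have refl: "generic (\<lambda>lam :: complex ^ 'l.
      (Rop s (R (lam $ x - lam $ y)) x y \<circ> Top (T (lam $ x)) x \<circ> Rop s (R (lam $ x + lam $ y)) y x
        \<circ> Top (T (lam $ y)) y :: ('l, 'v, 'w) tens \<Rightarrow> _)
      = Top (T (lam $ y)) y \<circ> Rop s (R (lam $ x + lam $ y)) x y \<circ> Top (T (lam $ x)) x
        \<circ> Rop s (R (lam $ x - lam $ y)) y x)" if d: "x \<noteq> y" for x y
  proof -
    let ?f = "\<lambda>lam :: complex ^ 'l. (lam $ x, lam $ y)"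
    have surj: "\<exists>lam. ?f lam = (a, b)" for a b
      using d by (intro exI[of _ "\<chi> i. if i = x then a else b"]) auto
    have lin: "linear ?f"
      by (rule linearI) simp_all
    show ?thesis
      by (rule generic_mono[OF generic_two_parameters[OF re[unfolded reflection_equation_def] lin surj]])
         (auto intro!: reflection_labelled[OF _ d])
  qed
  have diff_all: "generic (\<lambda>lam :: complex ^ 'l. \<forall>p q r. distinct [p, q, r] \<longrightarrow>
      yang_baxter_at s (R (lam $ p - lam $ q)) (R (lam $ p + lam $ r)) (R (lam $ q + lam $ r)) p q r)"
    (is "generic ?D")
    by (rule generic_finite_all)+ (rule generic_imp, rule diff)
  have sum_all: "generic (\<lambda>lam :: complex ^ 'l. \<forall>p q r. distinct [p, q, r] \<longrightarrow>
      yang_baxter_at s (R (lam $ p + lam $ q)) (R (lam $ p + lam $ r)) (R (lam $ r - lam $ q)) p q r)"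
    (is "generic ?S")
    by (rule generic_finite_all)+ (rule generic_imp, rule sum)
  have refl_all: "generic (\<lambda>lam :: complex ^ 'l. \<forall>x y. x \<noteq> y \<longrightarrow>
      (Rop s (R (lam $ x - lam $ y)) x y \<circ> Top (T (lam $ x)) x \<circ> Rop s (R (lam $ x + lam $ y)) y x
        \<circ> Top (T (lam $ y)) y :: ('l, 'v, 'w) tens \<Rightarrow> _)
      = Top (T (lam $ y)) y \<circ> Rop s (R (lam $ x + lam $ y)) x y \<circ> Top (T (lam $ x)) x
        \<circ> Rop s (R (lam $ x - lam $ y)) y x)"
    (is "generic ?F")
    by (rule generic_finite_all)+ (rule generic_imp, rule refl)
  show ?thesis
  proof (rule generic_mono[OF generic_conj[OF diff_all generic_conj[OF sum_all refl_all]]], elim conjE)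
    fix lam :: "complex ^ 'l"
    assume rel: "?D lam" "?S lam" "?F lam"
    show "exchange_point s R T lam"
      using rel by (intro exchange_point.intro[OF vs lin]) simp_all
  qed
qed

theorem lemma1:
  fixes R :: "complex \<Rightarrow> 'v::finite mat2"
    and V :: "'v mat1" and \<rho> :: complex
    and s :: "complex \<Rightarrow> 'w::ab_group_add \<Rightarrow> 'w"
    and T :: "complex \<Rightarrow> 'v \<Rightarrow> 'v \<Rightarrow> 'w \<Rightarrow> 'w"
    and N M' :: "'l::finite list"
  assumes "yang_baxter R"
    and "transp_symmetric R"
    and "unitarity R"
    and "V ** V = mat 1"
    and "crossing R V \<rho>"
    and "crossing_unitarity R (transpose V ** V) \<rho>"
    and "commutes_with R (transpose V ** V)"
    and "vector_space s"
    and "\<And>u a b. Vector_Spaces.linear s s (T u a b)"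
    and "reflection_equation s R T"
    and "distinct N" and "distinct M'" and "set N \<inter> set M' = {}"
  shows "generic (\<lambda>lam :: complex ^ 'l.
      fusedT s R T lam N
        \<circ> fusedR s R (\<lambda>x y. lam $ y + lam $ x) M' N
        \<circ> fusedT s R T lam M'
        \<circ> fusedR s R (\<lambda>x y. - lam $ x + lam $ y) (rev N) M'
      = fusedR s R (\<lambda>x y. - lam $ y + lam $ x) M' (rev N)
        \<circ> fusedT s R T lam M'
        \<circ> fusedR s R (\<lambda>x y. lam $ x + lam $ y) N M'
        \<circ> fusedT s R T lam N)"
proof (rule generic_mono)
  show "generic (\<lambda>lam :: complex ^ 'l. exchange_point s R T lam)"
    by (rule generic_exchange_point) fact+
next
  fix lam :: "complex ^ 'l"
  assume "exchange_point s R T lam"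
  then interpret exchange_point s R T lam .
  have arguments: "(\<lambda>x y. lam $ y + lam $ x) = (\<lambda>x y. lam $ x + lam $ y)"
    "(\<lambda>x y. - lam $ x + lam $ y) = (\<lambda>x y. lam $ y - lam $ x)"
    "(\<lambda>x y. - lam $ y + lam $ x) = (\<lambda>x y. lam $ x - lam $ y)"
    by (simp_all add: fun_eq_iff)
  show "fusedT s R T lam N
        \<circ> fusedR s R (\<lambda>x y. lam $ y + lam $ x) M' N
        \<circ> fusedT s R T lam M'
        \<circ> fusedR s R (\<lambda>x y. - lam $ x + lam $ y) (rev N) M'
      = fusedR s R (\<lambda>x y. - lam $ y + lam $ x) M' (rev N)
        \<circ> fusedT s R T lam M'
        \<circ> fusedR s R (\<lambda>x y. lam $ x + lam $ y) N M'
        \<circ> fusedT s R T lam N"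
    unfolding arguments using assms(11-13) by (rule reflection_fused)
qed

end
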